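(* Assume full pooling, $\alpha=1$. Then the characteristic function $V$ of the resource allocation game is superadditive, i.e. $V(c\cup d)\ge V(c)+V(d)$ for all disjoint coalitions $c,d\subseteq N$.
   Context: **Game.** $N$ is a finite player set, $R$ a finite item set, $I_j\subseteq N$ the set of players for whom item $j$ is available, $R_i=\{j\in R:i\in I_j\}$. Data: profits $p^i_j\ge0$, weights $a_j>0$, budgets $b^i$, capacities $u^i_j\ge 0$, private constraints $B^ix^i\le d^i$, and a pooling parameter $\alpha\in(0,1]$. For a coalition $c\subseteq N$ let $I^c_j=I_j\cap c$, $R^c=\{j:I^c_j\ne\emptyset\}$, $R^c_{\mathrm{ind}}=\{j\in R^c:|I^c_j|=1\}$, $R^c_{\mathrm{com}}=\{j\in R^c:|I^c_j|\ge2\}$. With variables $x^i=(x^i_j)_{j\in R_i}$ for $i\in c$ and $y^c_j$ for $j\in R^c_{\mathrm{com}}$, $V(c)$ is the maximum of $\sum_{j\in R^c}\sum_{i\in I^c_j}p^i_jx^i_j$ subject to: $\sum_{j\in R^c_{\mathrm{com}}}a_jy^c_j+\sum_{j\in R^c_{\mathrm{ind}}}\sum_{i\in I^c_j}a_jx^i_j\le\sum_{i\in c}b^i$; $y^c_j=\sum_{i\in I^c_j}x^i_j$ for $j\in R^c_{\mathrm{com}}$; $B^ix^i\le d^i$ for $i\in c$; $0\le x^i_j\le u^i_j$; $0\le y^c_j\le\alpha\sum_{i\in I^c_j}u^i_j$ and $y^c_j\in\mathbb Z_+$ for $j\in R^c_{\mathrm{com}}$; $x^i_j\in\mathbb Z_+$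 for $j\in R^c_{\mathrm{ind}}$ (the $x^i_j$ with $j\in R^c_{\mathrm{com}}$ are continuous). $V(\emptyset)=0$. Standing assumptions: every such program is feasible and bounded, the zero plan is feasible for every program, and the private constraints do not tie a member's common items to its other decisions. *)

theory Defs
  imports Complex_Main
begin

text \<open>
  The items available to player \<open>i\<close> are \<open>{j \<in> items G. i \<in> avail G j}\<close>.  The private constraint
  system of player \<open>i\<close> is the matrix inequality with \<open>nrows G i\<close> rows, coefficients
  \<open>priv_mat G i k j\<close> and right-hand side \<open>priv_rhs G i k\<close>, for \<open>k < nrows G i\<close>.
\<close>

record ('p, 'r) allocation_data =
  players :: "'p set"
  items :: "'r set"
  avail :: "'r \<Rightarrow> 'p set"
  profit :: "'p \<Rightarrow> 'r \<Rightarrow> real"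
  weight :: "'r \<Rightarrow> real"
  budget :: "'p \<Rightarrow> real"
  capacity :: "'p \<Rightarrow> 'r \<Rightarrow> real"
  nrows :: "'p \<Rightarrow> nat"
  priv_mat :: "'p \<Rightarrow> nat \<Rightarrow> 'r \<Rightarrow> real"
  priv_rhs :: "'p \<Rightarrow> nat \<Rightarrow> real"
  pooling :: real

definition items_of :: "('p, 'r) allocation_data \<Rightarrow> 'p \<Rightarrow> 'r set" where
  "items_of G i = {j \<in> items G. i \<in> avail G j}"

definition avail_in :: "('p, 'r) allocation_data \<Rightarrow> 'p set \<Rightarrow> 'r \<Rightarrow> 'p set" where
  "avail_in G c j = avail G j \<inter> c"

definition coal_items :: "('p, 'r) allocation_data \<Rightarrow> 'p set \<Rightarrow> 'r set" where
  "coal_items G c = {j \<in> items G. avail_in G c j \<noteq> {}}"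

definition ind_items :: "('p, 'r) allocation_data \<Rightarrow> 'p set \<Rightarrow> 'r set" where
  "ind_items G c = {j \<in> coal_items G c. card (avail_in G c j) = 1}"

definition com_items :: "('p, 'r) allocation_data \<Rightarrow> 'p set \<Rightarrow> 'r set" where
  "com_items G c = {j \<in> coal_items G c. card (avail_in G c j) \<ge> 2}"

definition private_feasible :: "('p, 'r) allocation_data \<Rightarrow> 'p \<Rightarrow> ('r \<Rightarrow> real) \<Rightarrow> bool" where
  "private_feasible G i xi \<longleftrightarrow>
     (\<forall>k < nrows G i. (\<Sum>j\<in>items_of G i. priv_mat G i k j * xi j) \<le> priv_rhs G i k) \<and>
     (\<forall>j\<in>items_of G i. 0 \<le> xi j \<and> xi j \<le> capacity G i j)"

text \<open>
  Plans are total functions; only the entries \<open>x i j\<close> with \<open>i \<in> c\<close>, \<open>j \<in> items_of G i\<close> and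
  \<open>y j\<close> with \<open>j \<in> com_items G c\<close> are variables of the program of \<open>c\<close>, and no other entry is
  constrained or enters the objective.
\<close>

definition feasible ::
  "('p, 'r) allocation_data \<Rightarrow> 'p set \<Rightarrow> ('p \<Rightarrow> 'r \<Rightarrow> real) \<Rightarrow> ('r \<Rightarrow> real) \<Rightarrow> bool" where
  "feasible G c x y \<longleftrightarrow>
     (\<Sum>j\<in>com_items G c. weight G j * y j)
       + (\<Sum>j\<in>ind_items G c. \<Sum>i\<in>avail_in G c j. weight G j * x i j) \<le> (\<Sum>i\<in>c. budget G i) \<and>
     (\<forall>j\<in>com_items G c. y j = (\<Sum>i\<in>avail_in G c j. x i j)) \<and>
     (\<forall>i\<in>c. private_feasible G i (x i)) \<and>
     (\<forall>j\<in>com_items G c. 0 \<le> y j \<and>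
        y j \<le> pooling G * (\<Sum>i\<in>avail_in G c j. capacity G i j) \<and> y j \<in> \<nat>) \<and>
     (\<forall>j\<in>ind_items G c. \<forall>i\<in>avail_in G c j. x i j \<in> \<nat>)"

definition total_profit ::
  "('p, 'r) allocation_data \<Rightarrow> 'p set \<Rightarrow> ('p \<Rightarrow> 'r \<Rightarrow> real) \<Rightarrow> real" where
  "total_profit G c x = (\<Sum>j\<in>coal_items G c. \<Sum>i\<in>avail_in G c j. profit G i j * x i j)"

definition plan_values :: "('p, 'r) allocation_data \<Rightarrow> 'p set \<Rightarrow> real set" where
  "plan_values G c = {total_profit G c x |x y. feasible G c x y}"

text \<open>
  \<open>Greatest\<close> denotes an attained maximum (not a supremum); it is meaningful because the bounds on
  the variables make every program below attain its optimum.
\<close>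

definition char_fun :: "('p, 'r) allocation_data \<Rightarrow> 'p set \<Rightarrow> real" where
  "char_fun G c = (if c = {} then 0 else (GREATEST v. v \<in> plan_values G c))"

text \<open>
  The assumption \<open>untied\<close> says that the private constraints do not tie a member's common items to
  its other decisions: in every coalition, the common part of one private plan of a member may be
  combined with the remaining part of another one.  It holds in particular if no row of the private
  system has nonzero coefficients both at a common item and at an individual item.
\<close>

locale resource_allocation_game =
  fixes G :: "('p, 'r) allocation_data"
  assumes finite_players: "finite (players G)"
    and finite_items: "finite (items G)"
    and avail_players: "j \<in> items G \<Longrightarrow> avail G j \<subseteq> players G"
    and profit_nonneg: "j \<in> items G \<Longrightarrow> i \<in> avail G j \<Longrightarrow> 0 \<le> profit G i j"
    and weight_pos: "j \<in> items G \<Longrightarrow> 0 < weight G j"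
    and capacity_nonneg: "j \<in> items G \<Longrightarrow> i \<in> avail G j \<Longrightarrow> 0 \<le> capacity G i j"
    and pooling_range: "0 < pooling G" "pooling G \<le> 1"
    and programs_feasible: "c \<subseteq> players G \<Longrightarrow> \<exists>x y. feasible G c x y"
    and programs_bounded: "c \<subseteq> players G \<Longrightarrow> bdd_above (plan_values G c)"
    and zero_feasible: "c \<subseteq> players G \<Longrightarrow> feasible G c (\<lambda>i j. 0) (\<lambda>j. 0)"
    and untied: "c \<subseteq> players G \<Longrightarrow> i \<in> c \<Longrightarrow>
      private_feasible G i xi \<Longrightarrow> private_feasible G i xi' \<Longrightarrow>
      private_feasible G i (\<lambda>j. if j \<in> com_items G c then xi j else xi' j)"

definition superadditive :: "'p set \<Rightarrow> ('p set \<Rightarrow> real) \<Rightarrow> bool" where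
  "superadditive N v \<longleftrightarrow>
     (\<forall>c d. c \<subseteq> N \<longrightarrow> d \<subseteq> N \<longrightarrow> c \<inter> d = {} \<longrightarrow> v (c \<union> d) \<ge> v c + v d)"

end

theory Submission
  imports Defs "HOL-Analysis.Function_Topology" "HOL-Analysis.Elementary_Normed_Spaces"
begin

text \<open>
  Under full pooling the variables \<open>y\<close> can be eliminated: a plan \<open>x\<close> is feasible for a coalition iff
  all its item totals are integral, the weighted totals respect the joint budget, and every member's
  private constraints hold.  For disjoint coalitions the totals, budgets and profits add, so optimal
  plans of \<open>c\<close> and \<open>d\<close> combine to a feasible plan of \<open>c \<union> d\<close>.  The optima are attained because the
  relevant entries range over a compact box in which these conditions cut out a closed set.
\<close>

text \<open>This is the forced value of \<open>y j\<close> at a common item, the single entry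
  \<open>x i j\<close> at an individual item, and 0 at an item of \<open>items G\<close> outside
  \<open>coal_items G c\<close>. One condition on totals thus covers the integrality of both kinds
  of variables.\<close>

definition item_total :: "('p, 'r) allocation_data \<Rightarrow> 'p set \<Rightarrow> ('p \<Rightarrow> 'r \<Rightarrow> real) \<Rightarrow> 'r \<Rightarrow> real" where
  "item_total G c x j = (\<Sum>i\<in>avail_in G c j. x i j)"

section \<open>Topology of the space of plans\<close>

lemma continuous_on_entry: "continuous_on S (\<lambda>x :: 'a \<Rightarrow> 'b \<Rightarrow> real. x i j)"
proof -
  have "continuous_on UNIV (\<lambda>x :: 'a \<Rightarrow> 'b \<Rightarrow> real. x i)"
    by (rule continuous_on_product_coordinates)
  then have "continuous_on UNIV (\<lambda>x :: 'a \<Rightarrow> 'b \<Rightarrow> real. x i j)"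
    by (rule continuous_on_product_then_coordinatewise)
  then show ?thesis
    using continuous_on_subset by blast
qed

lemma compact_entry_box:
  fixes U :: "'a \<Rightarrow> 'b \<Rightarrow> real"
  shows "compact {x. \<forall>i j. 0 \<le> x i j \<and> x i j \<le> U i j}"
proof -
  \<comment> \<open>Tychonoff's theorem for function types with the product topology. Plans are
    curried, so it is applied twice, once for players and once for items.\<close>
  have *: "compact (PiE UNIV S)"
    if "\<And>k. compact (S k)" for S :: "'k \<Rightarrow> 't :: topological_space set"
    using that compactin_PiE[of "\<lambda>_. euclidean" UNIV S]
    by (simp add: euclidean_product_topology)
  have "{x. \<forall>i j. 0 \<le> x i j \<and> x i j \<le> U i j} = PiE UNIV (\<lambda>i. PiE UNIV (\<lambda>j. {0..U i j}))"
    by (auto simp: PiE_UNIV_domain Pi_iff)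
  then show ?thesis
    by (simp only:) (intro * compact_Icc)
qed

context resource_allocation_game
begin

section \<open>Item classes and item totals\<close>

lemma finite_coalition: "c \<subseteq> players G \<Longrightarrow> finite c"
  using finite_players finite_subset by blast

lemma finite_avail_in: "c \<subseteq> players G \<Longrightarrow> finite (avail_in G c j)"
  by (simp add: avail_in_def finite_coalition)

lemma coal_items_split:
  assumes "c \<subseteq> players G"
  shows "coal_items G c = com_items G c \<union> ind_items G c" "com_items G c \<inter> ind_items G c = {}"
proof -
  have "card (avail_in G c j) = 1 \<or> 2 \<le> card (avail_in G c j)" if "j \<in> coal_items G c" for j
  proof -
    \<comment> \<open>Finiteness matters: an infinite set would have \<open>card\<close> 0 too and
      fall into neither class.\<close>
    have "card (avail_in G c j) \<noteq> 0"
      using that finite_avail_in[OF assms] by (simp add: coal_items_def)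
    then show ?thesis by linarith
  qed
  then show "coal_items G c = com_items G c \<union> ind_items G c" "com_items G c \<inter> ind_items G c = {}"
    by (auto simp: com_items_def ind_items_def)
qed

lemma finite_item_classes:
  "finite (coal_items G c)" "finite (com_items G c)" "finite (ind_items G c)"
  using finite_items by (auto simp: coal_items_def com_items_def ind_items_def)

lemma item_total_eq_0: "j \<in> items G - coal_items G c \<Longrightarrow> item_total G c x j = 0"
  by (auto simp: item_total_def coal_items_def)

text \<open>The right-hand side is the budget usage of the program with \<open>y\<close> replaced by
  totals. The left-hand side sums over an index set independent of \<open>c\<close>; this is what
  lets usages add although an item may be individual for two coalitions and common for their
  union.\<close>

lemma total_weight_split:
  assumes "c \<subseteq> players G"
  shows "(\<Sum>j\<in>items G. weight G j * item_total G c x j) =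
    (\<Sum>j\<in>com_items G c. weight G j * item_total G c x j) +
    (\<Sum>j\<in>ind_items G c. \<Sum>i\<in>avail_in G c j. weight G j * x i j)"
proof -
  have "(\<Sum>j\<in>items G. weight G j * item_total G c x j) =
      (\<Sum>j\<in>coal_items G c. weight G j * item_total G c x j)"
    using item_total_eq_0
    by (intro sum.mono_neutral_right) (auto simp: finite_items coal_items_def)
  also have "\<dots> = (\<Sum>j\<in>com_items G c. weight G j * item_total G c x j) +
      (\<Sum>j\<in>ind_items G c. weight G j * item_total G c x j)"
    unfolding coal_items_split(1)[OF assms]
    by (intro sum.union_disjoint finite_item_classes coal_items_split(2)[OF assms])
  finally show ?thesis
    by (simp add: item_total_def sum_distrib_left)
qed

lemma item_total_ind:
  assumes "j \<in> ind_items G c" "i \<in> avail_in G c j"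
  shows "item_total G c x j = x i j"
proof -
  have "avail_in G c j = {i}"
    using assms by (auto simp: ind_items_def card_1_singleton_iff)
  then show ?thesis by (simp add: item_total_def)
qed

section \<open>Elimination of the variables \<open>y\<close>\<close>

lemma feasible_imp:
  assumes "c \<subseteq> players G" "feasible G c x y"
  shows "(\<Sum>j\<in>items G. weight G j * item_total G c x j) \<le> (\<Sum>i\<in>c. budget G i)"
    and "\<forall>j\<in>items G. item_total G c x j \<in> \<nat>"
    and "\<forall>i\<in>c. private_feasible G i (x i)"
proof -
  have y: "y j = item_total G c x j" if "j \<in> com_items G c" for j
    using assms(2) that by (simp add: feasible_def item_total_def)
  show "(\<Sum>j\<in>items G. weight G j * item_total G c x j) \<le> (\<Sum>i\<in>c. budget G i)"
  proof -
    have "(\<Sum>j\<in>com_items G c. weight G j * item_total G c x j) =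
        (\<Sum>j\<in>com_items G c. weight G j * y j)"
      by (rule sum.cong) (simp_all add: y)
    then show ?thesis
      using assms(2) unfolding feasible_def total_weight_split[OF assms(1)] by argo
  qed
  show "\<forall>j\<in>items G. item_total G c x j \<in> \<nat>"
  proof
    fix j assume j: "j \<in> items G"
    \<comment> \<open>Integrality has a different source in each class: an empty sum, the condition
      on \<open>y j\<close>, the condition on the only entry \<open>x i j\<close>.\<close>
    consider "j \<notin> coal_items G c" | "j \<in> com_items G c" | "j \<in> ind_items G c"
      using coal_items_split(1)[OF assms(1)] by blast
    then show "item_total G c x j \<in> \<nat>"
    proof cases
      case 1
      then show ?thesis using j item_total_eq_0[of j c x] by simp
    next
      case 2
      then have "y j \<in> \<nat>"
        using assms(2) unfolding feasible_def by blast
      then show ?thesis using y[OF 2] by simp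
    next
      case 3
      then obtain i where i: "i \<in> avail_in G c j"
        by (auto simp: ind_items_def coal_items_def)
      then have "x i j \<in> \<nat>"
        using assms(2) 3 by (simp add: feasible_def)
      then show ?thesis using item_total_ind[OF 3 i] by simp
    qed
  qed
  show "\<forall>i\<in>c. private_feasible G i (x i)"
    using assms(2) by (simp add: feasible_def)
qed

text \<open>Full pooling enters here: summing the individual bounds
  \<open>x i j \<le> capacity G i j\<close> over the members gives exactly the upper bound on
  \<open>y j\<close> for \<alpha> = 1.\<close>

lemma feasible_item_totalI:
  assumes "c \<subseteq> players G" "pooling G = 1"
    and "(\<Sum>j\<in>items G. weight G j * item_total G c x j) \<le> (\<Sum>i\<in>c. budget G i)"
    and "\<forall>j\<in>items G. item_total G c x j \<in> \<nat>"
    and priv: "\<forall>i\<in>c. private_feasible G i (x i)"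
  shows "feasible G c x (item_total G c x)"
proof -
  have items: "com_items G c \<subseteq> items G" "ind_items G c \<subseteq> items G"
    by (auto simp: com_items_def ind_items_def coal_items_def)
  have bnd: "0 \<le> x i j" "x i j \<le> capacity G i j" if "j \<in> items G" "i \<in> avail_in G c j" for i j
    using priv that by (auto simp: private_feasible_def items_of_def avail_in_def)
  have "0 \<le> item_total G c x j"
    "item_total G c x j \<le> pooling G * (\<Sum>i\<in>avail_in G c j. capacity G i j)"
    if "j \<in> items G" for j
    using bnd that by (auto simp: item_total_def assms(2) intro!: sum_nonneg sum_mono)
  moreover have "x i j \<in> \<nat>" if "j \<in> ind_items G c" "i \<in> avail_in G c j" for i j
    using assms(4) items that item_total_ind[OF that, of x] by force
  ultimately show ?thesis
    using assms(3,4) priv items unfolding feasible_def total_weight_split[OF assms(1)]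
    by (auto simp: item_total_def)
qed

section \<open>Additivity of sums and dependence on the program variables only\<close>

lemma total_profit_items:
  "total_profit G c x = (\<Sum>j\<in>items G. \<Sum>i\<in>avail_in G c j. profit G i j * x i j)"
  unfolding total_profit_def
  by (rule sum.mono_neutral_left) (auto simp: finite_items coal_items_def)

lemma sum_avail_in_Un:
  fixes f :: "'p \<Rightarrow> real"
  assumes "c \<subseteq> players G" "d \<subseteq> players G" "c \<inter> d = {}"
  shows "sum f (avail_in G (c \<union> d) j) = sum f (avail_in G c j) + sum f (avail_in G d j)"
proof -
  have "avail_in G (c \<union> d) j = avail_in G c j \<union> avail_in G d j"
    "avail_in G c j \<inter> avail_in G d j = {}"
    using assms by (auto simp: avail_in_def)
  then show ?thesis
    using assms by (simp add: sum.union_disjoint finite_avail_in)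
qed

lemma item_total_cong:
  "(\<And>i. i \<in> c \<Longrightarrow> i \<in> avail G j \<Longrightarrow> x i j = x' i j) \<Longrightarrow> item_total G c x j = item_total G c x' j"
  by (auto simp: item_total_def avail_in_def intro!: sum.cong)

lemma total_profit_cong:
  "(\<And>i j. i \<in> c \<Longrightarrow> j \<in> items_of G i \<Longrightarrow> x i j = x' i j) \<Longrightarrow> total_profit G c x = total_profit G c x'"
  by (auto simp: total_profit_items avail_in_def items_of_def intro!: sum.cong)

lemma private_feasible_cong:
  assumes "\<And>j. j \<in> items_of G i \<Longrightarrow> z j = z' j"
  shows "private_feasible G i z \<longleftrightarrow> private_feasible G i z'"
proof -
  have "(\<Sum>j\<in>items_of G i. priv_mat G i k j * z j) = (\<Sum>j\<in>items_of G i. priv_mat G i k j * z' j)"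
    for k using assms by (intro sum.cong) auto
  then show ?thesis
    using assms by (auto simp: private_feasible_def)
qed

section \<open>Attainment of the maximum\<close>

lemma compact_plan_values:
  assumes c: "c \<subseteq> players G" and pool: "pooling G = 1"
  shows "compact (plan_values G c)"
proof -
  \<comment> \<open>Entries that are not variables of the program are unconstrained, so the set of
    all feasible plans need not be compact. The bound 0 pins these entries to 0.\<close>
  define U where "U i j = (if i \<in> c \<and> j \<in> items_of G i then capacity G i j else 0)" for i j
  let ?box = "{x. \<forall>i j. 0 \<le> x i j \<and> x i j \<le> U i j}"
  let ?budget = "{x. (\<Sum>j\<in>items G. weight G j * item_total G c x j) \<le> (\<Sum>i\<in>c. budget G i)}"
  let ?int = "\<Inter>j\<in>items G. {x. item_total G c x j \<in> \<nat>}"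
  let ?priv = "\<Inter>i\<in>c. \<Inter>k\<in>{..<nrows G i}.
    {x. (\<Sum>j\<in>items_of G i. priv_mat G i k j * x i j) \<le> priv_rhs G i k}"
  have "closed ?budget"
    unfolding item_total_def by (intro closed_Collect_le continuous_intros continuous_on_entry)
  moreover have "closed ?int"
  proof (intro closed_INT ballI)
    fix j
    have "continuous_on UNIV (\<lambda>x. item_total G c x j)"
      unfolding item_total_def by (intro continuous_intros continuous_on_entry)
    \<comment> \<open>The naturals are closed in the reals, so integrality survives limits even
      though the single entries of common items vary continuously.\<close>
    then have "closed ((\<lambda>x. item_total G c x j) -` \<nat>)"
      by (rule closed_vimage[OF closed_Nats])
    then show "closed {x. item_total G c x j \<in> \<nat>}"
      by (simp add: vimage_def)
  qed
  moreover have "closed ?priv"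
    by (intro closed_INT ballI closed_Collect_le continuous_intros continuous_on_entry)
  ultimately have "compact (?box \<inter> (?budget \<inter> ?int \<inter> ?priv))"
    by (intro compact_Int_closed compact_entry_box closed_Int)
  moreover have "continuous_on S (total_profit G c)" for S
    unfolding total_profit_def by (intro continuous_intros continuous_on_entry)
  moreover have "plan_values G c = total_profit G c ` (?box \<inter> (?budget \<inter> ?int \<inter> ?priv))"
  proof (intro equalityI subsetI)
    fix v assume "v \<in> plan_values G c"
    then obtain x y where v: "v = total_profit G c x" and "feasible G c x y"
      by (auto simp: plan_values_def)
    note feas = feasible_imp[OF c this(2)]
    \<comment> \<open>Truncation moves the plan into the box and keeps its totals, private
      feasibility and profit.\<close>
    define x' where "x' i j = (if i \<in> c \<and> j \<in> items_of G i then x i j else 0)" for i j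
    have tot: "item_total G c x' j = item_total G c x j" if "j \<in> items G" for j
      using that by (intro item_total_cong) (simp add: x'_def items_of_def)
    have priv: "private_feasible G i (x' i)" if "i \<in> c" for i
      using feas(3) that private_feasible_cong[of i "x' i" "x i"] by (simp add: x'_def)
    have "x' \<in> ?box"
      using priv by (auto simp: U_def private_feasible_def) (auto simp: x'_def)
    moreover have "x' \<in> ?budget" "x' \<in> ?int" using feas tot by auto
    moreover have "x' \<in> ?priv" using priv by (auto simp: private_feasible_def)
    moreover have "v = total_profit G c x'"
      unfolding v by (rule total_profit_cong) (simp add: x'_def)
    ultimately show "v \<in> total_profit G c ` (?box \<inter> (?budget \<inter> ?int \<inter> ?priv))" by blast
  next
    fix v assume "v \<in> total_profit G c ` (?box \<inter> (?budget \<inter> ?int \<inter> ?priv))"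
    then obtain x where v: "v = total_profit G c x"
      and box: "x \<in> ?box" and x: "x \<in> ?budget" "x \<in> ?int" "x \<in> ?priv" by blast
    have "x i j \<le> capacity G i j" if "i \<in> c" "j \<in> items_of G i" for i j
    proof -
      have "x i j \<le> U i j" using box by blast
      then show ?thesis using that by (simp add: U_def)
    qed
    then have "\<forall>i\<in>c. private_feasible G i (x i)"
      using box x(3) by (auto simp: private_feasible_def)
    then have "feasible G c x (item_total G c x)"
      using x by (intro feasible_item_totalI[OF c pool]) auto
    then show "v \<in> plan_values G c"
      unfolding v plan_values_def by blast
  qed
  ultimately show ?thesis
    by (simp only: compact_continuous_image)
qed

text \<open>\<open>Greatest\<close> is informative only when the maximum is attained, which a mere
  upper bound would not ensure; compactness and the zero plan supply it.\<close>

lemma char_fun_greatest: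
  assumes c: "c \<subseteq> players G" and pool: "pooling G = 1"
  shows "char_fun G c \<in> plan_values G c" "v \<in> plan_values G c \<Longrightarrow> v \<le> char_fun G c"
proof -
  have "plan_values G c \<noteq> {}"
    using zero_feasible[OF c] by (auto simp: plan_values_def)
  then obtain m where m: "m \<in> plan_values G c" "\<And>v. v \<in> plan_values G c \<Longrightarrow> v \<le> m"
    using compact_attains_sup[OF compact_plan_values[OF c pool]] by blast
  then have "(GREATEST v. v \<in> plan_values G c) = m"
    by (intro Greatest_equality)
  \<comment> \<open>The separate clause for the empty coalition agrees with its program, whose only
    value is an empty sum.\<close>
  moreover have "m = 0" if "c = {}"
    using m(1) that by (auto simp: plan_values_def total_profit_def coal_items_def avail_in_def)
  ultimately have "char_fun G c = m"
    by (simp add: char_fun_def)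
  then show "char_fun G c \<in> plan_values G c" "v \<in> plan_values G c \<Longrightarrow> v \<le> char_fun G c"
    using m by auto
qed

section \<open>Merging plans of disjoint coalitions\<close>

lemma plan_values_Un:
  assumes c: "c \<subseteq> players G" and d: "d \<subseteq> players G" and disj: "c \<inter> d = {}"
    and pool: "pooling G = 1"
    and v: "v \<in> plan_values G c" and w: "w \<in> plan_values G d"
  shows "v + w \<in> plan_values G (c \<union> d)"
proof -
  obtain x x' y y' where v: "v = total_profit G c x" and "feasible G c x y"
    and w: "w = total_profit G d x'" and "feasible G d x' y'"
    using v w by (auto simp: plan_values_def)
  note fc = feasible_imp[OF c this(2)] and fd = feasible_imp[OF d this(4)]
  \<comment> \<open>Each member keeps its own plan; disjointness ensures that \<open>z\<close>
    agrees with \<open>x'\<close> on \<open>d\<close>.\<close>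
  define z where "z i = (if i \<in> c then x i else x' i)" for i
  have z: "z i = x i" if "i \<in> c" for i
    using that by (simp add: z_def)
  have z': "z i = x' i" if "i \<in> d" for i
    using that disj by (auto simp: z_def)
  have tot: "item_total G (c \<union> d) z j = item_total G c x j + item_total G d x' j" for j
  proof -
    have "item_total G (c \<union> d) z j = item_total G c z j + item_total G d z j"
      unfolding item_total_def by (rule sum_avail_in_Un[OF c d disj])
    also have "item_total G c z j = item_total G c x j"
      by (rule item_total_cong) (simp add: z)
    also have "item_total G d z j = item_total G d x' j"
      by (rule item_total_cong) (simp add: z')
    finally show ?thesis .
  qed
  \<comment> \<open>The new \<open>y\<close> is taken to be the merged totals. An item individual
    for both \<open>c\<close> and \<open>d\<close> becomes common, and its total is a sum of two
    naturals.\<close>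
  have "feasible G (c \<union> d) z (item_total G (c \<union> d) z)"
  proof (rule feasible_item_totalI)
    have "(\<Sum>i\<in>c \<union> d. budget G i) = (\<Sum>i\<in>c. budget G i) + (\<Sum>i\<in>d. budget G i)"
      using c d disj by (intro sum.union_disjoint finite_coalition)
    then show "(\<Sum>j\<in>items G. weight G j * item_total G (c \<union> d) z j) \<le> (\<Sum>i\<in>c \<union> d. budget G i)"
      using fc(1) fd(1) by (simp add: tot distrib_left sum.distrib)
    show "\<forall>j\<in>items G. item_total G (c \<union> d) z j \<in> \<nat>"
      using fc(2) fd(2) by (simp add: tot)
    show "\<forall>i\<in>c \<union> d. private_feasible G i (z i)"
      using fc(3) fd(3) z z' by auto
  qed (use c d pool in auto)
  moreover have "total_profit G (c \<union> d) z = v + w"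
  proof -
    have "total_profit G (c \<union> d) z = total_profit G c z + total_profit G d z"
      by (simp add: total_profit_items sum_avail_in_Un[OF c d disj] sum.distrib)
    also have "total_profit G c z = v"
      unfolding v by (rule total_profit_cong) (simp add: z)
    also have "total_profit G d z = w"
      unfolding w by (rule total_profit_cong) (simp add: z')
    finally show ?thesis .
  qed
  ultimately show ?thesis
    unfolding plan_values_def by (intro CollectI exI conjI) (rule sym)
qed

end

theorem proposition1:
  fixes G :: "('p, 'r) allocation_data"
  assumes "resource_allocation_game G"
    and "pooling G = 1"
  shows "superadditive (players G) (char_fun G)"
  unfolding superadditive_def
proof (intro allI impI)
  interpret resource_allocation_game G by fact
  fix c d assume "c \<subseteq> players G" "d \<subseteq> players G" "c \<inter> d = {}"
  then show "char_fun G (c \<union> d) \<ge> char_fun G c + char_fun G d"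
    by (intro char_fun_greatest(2) plan_values_Un char_fun_greatest(1) assms(2)) auto
qed

end
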